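(* There exist a nonzero complex Hilbert space $H$ and a densely defined, essentially self-adjoint linear operator $A$ on $H$, with domain $D(A)\subset H$, such that $$D(A^2)=\{0\}.$$
   Context: An operator on a Hilbert space $H$ is a linear map $A:D(A)\to H$ defined on a linear subspace $D(A)\subset H$ (its domain). A densely defined operator $A$ is essentially self-adjoint if it is symmetric (hence closable) and its closure is self-adjoint, equivalently $\overline{A}=A^*$. The domain of the square is $D(A^2)=\{x\in D(A): Ax\in D(A)\}$. *)

theory Defs
  imports "HOL-Analysis.Analysis" "HOL-Library.Function_Algebras"
begin

section \<open>Complex Hilbert spaces\<close>

text \<open>
  The underlying set of a space is a subspace \<open>H\<close> of an ambient complex vector space, given
  by a type of class \<open>ab_group_add\<close> and a scalar multiplication on it.  Only the values of
  \<open>cinner\<close> on \<open>H\<close> matter.  The inner product is linear in its first argument.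
\<close>

locale complex_inner_space = vector_space scale
  for scale :: "complex \<Rightarrow> 'a::ab_group_add \<Rightarrow> 'a" +
  fixes H :: "'a set"
    and cinner :: "'a \<Rightarrow> 'a \<Rightarrow> complex"
  assumes subspace_H: "subspace H"
    and cinner_add_left:
      "\<lbrakk>x \<in> H; y \<in> H; z \<in> H\<rbrakk> \<Longrightarrow> cinner (x + y) z = cinner x z + cinner y z"
    and cinner_scale_left:
      "\<lbrakk>x \<in> H; y \<in> H\<rbrakk> \<Longrightarrow> cinner (scale c x) y = c * cinner x y"
    and cinner_commute:
      "\<lbrakk>x \<in> H; y \<in> H\<rbrakk> \<Longrightarrow> cinner x y = cnj (cinner y x)"
    and cinner_pos:
      "\<lbrakk>x \<in> H; x \<noteq> 0\<rbrakk> \<Longrightarrow> 0 < Re (cinner x x)"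
begin

definition cnorm :: "'a \<Rightarrow> real" where
  "cnorm x = sqrt (Re (cinner x x))"

text \<open>The value 0 outside \<open>H\<close> is irrelevant; the library's metric spaces require a
  distance function that is symmetric and nonnegative on the whole type.\<close>

definition cdist :: "'a \<Rightarrow> 'a \<Rightarrow> real" where
  "cdist x y = (if x \<in> H \<and> y \<in> H then cnorm (x - y) else 0)"

lemma H_closed [simp]:
  "0 \<in> H"
  "\<lbrakk>x \<in> H; y \<in> H\<rbrakk> \<Longrightarrow> x + y \<in> H"
  "\<lbrakk>x \<in> H; y \<in> H\<rbrakk> \<Longrightarrow> x - y \<in> H"
  "x \<in> H \<Longrightarrow> scale c x \<in> H"
  "x \<in> H \<Longrightarrow> - x \<in> H"
  using subspace_H by (auto intro: subspace_0 subspace_add subspace_diff subspace_scale subspace_neg)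

lemma cinner_minus_left:
  assumes "x \<in> H" "y \<in> H" shows "cinner (- x) y = - cinner x y"
  using cinner_scale_left[of x y "-1"] assms by simp

lemma cinner_diff_left:
  assumes "x \<in> H" "y \<in> H" "z \<in> H" shows "cinner (x - y) z = cinner x z - cinner y z"
  using cinner_add_left[of x "- y" z] cinner_minus_left[of y z] assms by simp

lemma cinner_add_right:
  assumes "x \<in> H" "y \<in> H" "z \<in> H" shows "cinner z (x + y) = cinner z x + cinner z y"
  using assms cinner_add_left[of x y z]
    cinner_commute[of z "x + y"] cinner_commute[of z x] cinner_commute[of z y] by simp

lemma cinner_diff_right:
  assumes "x \<in> H" "y \<in> H" "z \<in> H" shows "cinner z (x - y) = cinner z x - cinner z y"
  using assms cinner_diff_left[of x y z]
    cinner_commute[of z "x - y"] cinner_commute[of z x] cinner_commute[of z y] by simp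

lemma cinner_scale_right:
  assumes "x \<in> H" "y \<in> H" shows "cinner x (scale c y) = cnj c * cinner x y"
  using assms cinner_scale_left[of y x c]
    cinner_commute[of x "scale c y"] cinner_commute[of x y] by simp

lemma cinner_zero_left [simp]: "x \<in> H \<Longrightarrow> cinner 0 x = 0"
  using cinner_diff_left[of 0 0 x] by simp

lemma cinner_zero_right [simp]: "x \<in> H \<Longrightarrow> cinner x 0 = 0"
  using cinner_diff_right[of 0 0 x] by simp

lemma cinner_self_nonneg: "x \<in> H \<Longrightarrow> 0 \<le> Re (cinner x x)"
  using cinner_pos[of x] by (cases "x = 0") auto

lemma cinner_self:
  assumes "x \<in> H" shows "cinner x x = of_real ((cnorm x)\<^sup>2)"
proof -
  have "Im (cinner x x) = 0"
    using arg_cong[OF cinner_commute[OF assms assms], of Im] by simp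
  then show ?thesis
    using cinner_self_nonneg[OF assms] by (simp add: cnorm_def complex_eq_iff)
qed

lemma cnorm_nonneg: "x \<in> H \<Longrightarrow> 0 \<le> cnorm x"
  by (simp add: cnorm_def cinner_self_nonneg)

lemma cnorm_eq_0: "x \<in> H \<Longrightarrow> cnorm x = 0 \<longleftrightarrow> x = 0"
  using cinner_pos[of x] by (cases "x = 0") (auto simp: cnorm_def)

lemma Cauchy_Schwarz:
  assumes x: "x \<in> H" and y: "y \<in> H"
  shows "norm (cinner x y) \<le> cnorm x * cnorm y"
proof (cases "y = 0")
  case True
  then show ?thesis using x by (simp add: cnorm_def)
next
  case False
  define b where "b = (cnorm y)\<^sup>2"
  have b: "b > 0" using False y cnorm_eq_0[OF y] by (simp add: b_def)
  define p where "p = cinner x y"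
  define c where "c = p / of_real b"
  let ?z = "x - scale c y"
  have yx: "cinner y x = cnj p" using cinner_commute[OF y x] by (simp add: p_def)
  have "cinner ?z ?z = cinner x x - cnj c * p - (c * cnj p - c * (cnj c * cinner y y))"
    using x y yx by (simp add: cinner_diff_left cinner_diff_right cinner_scale_left
        cinner_scale_right p_def[symmetric] algebra_simps)
  also have "\<dots> = cinner x x - p * cnj p / of_real b"
    using b cinner_self[OF y] by (simp add: c_def b_def[symmetric] field_simps)
  also have "\<dots> = of_real ((cnorm x)\<^sup>2 - (norm p)\<^sup>2 / b)"
    using cinner_self[OF x] by (simp add: complex_norm_square[symmetric])
  finally have "Re (cinner ?z ?z) = (cnorm x)\<^sup>2 - (norm p)\<^sup>2 / b" by simp
  then have "(norm p)\<^sup>2 / b \<le> (cnorm x)\<^sup>2"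
    using cinner_self_nonneg[of ?z] x y by simp
  then have "(norm p)\<^sup>2 \<le> (cnorm x * cnorm y)\<^sup>2"
    using b by (simp add: b_def[symmetric] power_mult_distrib field_simps)
  then show ?thesis
    using power2_le_imp_le[of "norm p" "cnorm x * cnorm y"] cnorm_nonneg[OF x] cnorm_nonneg[OF y]
    by (simp add: p_def)
qed

lemma cnorm_triangle:
  assumes x: "x \<in> H" and y: "y \<in> H"
  shows "cnorm (x + y) \<le> cnorm x + cnorm y"
proof (rule power2_le_imp_le)
  have "Re (cinner (x + y) (x + y)) = (cnorm x)\<^sup>2 + (cnorm y)\<^sup>2 + 2 * Re (cinner x y)"
    using x y cinner_commute[OF y x] cinner_self[OF x] cinner_self[OF y]
    by (simp add: cinner_add_left cinner_add_right)
  moreover have "Re (cinner x y) \<le> cnorm x * cnorm y"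
    using Cauchy_Schwarz[OF x y] complex_Re_le_cmod order_trans by blast
  moreover have "(cnorm (x + y))\<^sup>2 = Re (cinner (x + y) (x + y))"
    using x y by (simp add: cnorm_def cinner_self_nonneg)
  ultimately show "(cnorm (x + y))\<^sup>2 \<le> (cnorm x + cnorm y)\<^sup>2"
    by (simp add: power2_sum)
  show "0 \<le> cnorm x + cnorm y" using x y by (simp add: cnorm_nonneg)
qed

lemma cnorm_minus_commute:
  assumes "x \<in> H" "y \<in> H" shows "cnorm (x - y) = cnorm (y - x)"
  using assms by (simp add: cnorm_def cinner_diff_left cinner_diff_right algebra_simps)

sublocale hs: Metric_space H cdist
proof
  show "0 \<le> cdist x y" for x y by (simp add: cdist_def cnorm_nonneg)
  show "cdist x y = cdist y x" for x y by (simp add: cdist_def cnorm_minus_commute)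
  show "cdist x y = 0 \<longleftrightarrow> x = y" if "x \<in> H" "y \<in> H" for x y
    using that by (simp add: cdist_def cnorm_eq_0)
  show "cdist x z \<le> cdist x y + cdist y z" if "x \<in> H" "y \<in> H" "z \<in> H" for x y z
    using that cnorm_triangle[of "x - y" "y - z"] by (simp add: cdist_def)
qed


section \<open>Unbounded operators\<close>

text \<open>
  An operator is given by its domain \<open>D\<close> and a function \<open>A\<close> of which only the values on
  \<open>D\<close> matter.
\<close>

definition linear_operator :: "'a set \<Rightarrow> ('a \<Rightarrow> 'a) \<Rightarrow> bool" where
  "linear_operator D A \<longleftrightarrow>
     subspace D \<and> D \<subseteq> H \<and> (\<forall>x\<in>D. A x \<in> H) \<and>
     (\<forall>x\<in>D. \<forall>y\<in>D. A (x + y) = A x + A y) \<and>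
     (\<forall>c. \<forall>x\<in>D. A (scale c x) = scale c (A x))"

definition densely_defined :: "'a set \<Rightarrow> ('a \<Rightarrow> 'a) \<Rightarrow> bool" where
  "densely_defined D A \<longleftrightarrow> linear_operator D A \<and> hs.mtopology closure_of D = H"

definition symmetric_operator :: "'a set \<Rightarrow> ('a \<Rightarrow> 'a) \<Rightarrow> bool" where
  "symmetric_operator D A \<longleftrightarrow> (\<forall>x\<in>D. \<forall>y\<in>D. cinner (A x) y = cinner x (A y))"

text \<open>For a densely defined operator the vector \<open>z\<close> below is unique, see
  \<open>adjoint_unique\<close>.\<close>

definition adjoint_dom :: "'a set \<Rightarrow> ('a \<Rightarrow> 'a) \<Rightarrow> 'a set" where
  "adjoint_dom D A = {y \<in> H. \<exists>z\<in>H. \<forall>x\<in>D. cinner (A x) y = cinner x z}"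

definition adjoint_op :: "'a set \<Rightarrow> ('a \<Rightarrow> 'a) \<Rightarrow> 'a \<Rightarrow> 'a" where
  "adjoint_op D A y = (THE z. z \<in> H \<and> (\<forall>x\<in>D. cinner (A x) y = cinner x z))"

definition self_adjoint :: "'a set \<Rightarrow> ('a \<Rightarrow> 'a) \<Rightarrow> bool" where
  "self_adjoint D A \<longleftrightarrow>
     densely_defined D A \<and> adjoint_dom D A = D \<and> (\<forall>x\<in>D. adjoint_op D A x = A x)"

text \<open>
  The closure of an operator is the operator whose graph is the closure of its graph in
  \<open>H \<times> H\<close>.  This requires the operator to be closable, that is, the closure of the graph to be
  single-valued; densely defined symmetric operators are closable, see \<open>closure_unique\<close>.
\<close>

definition closure_graph :: "'a set \<Rightarrow> ('a \<Rightarrow> 'a) \<Rightarrow> ('a \<times> 'a) set" where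
  "closure_graph D A =
     (prod_topology hs.mtopology hs.mtopology) closure_of ((\<lambda>x. (x, A x)) ` D)"

definition closure_dom :: "'a set \<Rightarrow> ('a \<Rightarrow> 'a) \<Rightarrow> 'a set" where
  "closure_dom D A = fst ` closure_graph D A"

definition closure_op :: "'a set \<Rightarrow> ('a \<Rightarrow> 'a) \<Rightarrow> 'a \<Rightarrow> 'a" where
  "closure_op D A x = (THE y. (x, y) \<in> closure_graph D A)"

definition essentially_self_adjoint :: "'a set \<Rightarrow> ('a \<Rightarrow> 'a) \<Rightarrow> bool" where
  "essentially_self_adjoint D A \<longleftrightarrow>
     densely_defined D A \<and> symmetric_operator D A \<and>
     self_adjoint (closure_dom D A) (closure_op D A)"

lemma adjoint_unique:
  assumes D: "densely_defined D A"
    and z: "z \<in> H" "\<forall>x\<in>D. cinner (A x) y = cinner x z"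
    and z': "z' \<in> H" "\<forall>x\<in>D. cinner (A x) y = cinner x z'"
  shows "z = z'"
proof (rule ccontr)
  assume "z \<noteq> z'"
  define w where "w = z - z'"
  have w: "w \<in> H" "w \<noteq> 0" using z z' \<open>z \<noteq> z'\<close> by (auto simp: w_def)
  then have pos: "cnorm w > 0" using cnorm_nonneg[of w] cnorm_eq_0[of w] by simp
  have DH: "D \<subseteq> H" using D by (simp add: densely_defined_def linear_operator_def)
  have "w \<in> hs.mtopology closure_of D" using D w by (simp add: densely_defined_def)
  then obtain x where x: "x \<in> D" "cdist w x < cnorm w"
    using pos by (auto simp: hs.metric_closure_of)
  then have xH: "x \<in> H" using DH by blast
  have "cinner x w = 0" using x z z' xH by (auto simp: w_def cinner_diff_right)
  then have "cinner w w = cinner (w - x) w" using xH w by (simp add: cinner_diff_left)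
  then have "(cnorm w)\<^sup>2 = norm (cinner (w - x) w)"
    using cinner_self[OF w(1)] by (metis norm_of_real abs_of_nonneg zero_le_power2)
  also have "\<dots> \<le> cnorm (w - x) * cnorm w" using Cauchy_Schwarz xH w by simp
  also have "\<dots> < cnorm w * cnorm w" using x xH w pos by (simp add: cdist_def)
  finally show False by (simp add: power2_eq_square)
qed

lemma closure_graph_adjoint:
  assumes D: "densely_defined D A" and S: "symmetric_operator D A"
    and xy: "(x, y) \<in> closure_graph D A"
  shows "x \<in> H" "y \<in> H" "\<forall>u\<in>D. cinner (A u) x = cinner u y"
proof -
  have *: "(x, y) \<in> topspace (prod_topology hs.mtopology hs.mtopology)"
    using xy closure_of_subset_topspace unfolding closure_graph_def by (rule subsetD[rotated])
  then show x: "x \<in> H" and y: "y \<in> H" by auto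
  show "\<forall>u\<in>D. cinner (A u) x = cinner u y"
  proof
    fix u assume u: "u \<in> D"
    have DH: "D \<subseteq> H" "\<forall>x\<in>D. A x \<in> H"
      using D by (simp_all add: densely_defined_def linear_operator_def)
    then have uH: "u \<in> H" "A u \<in> H" using u by auto
    have "norm (cinner (A u) x - cinner u y) \<le> e * (cnorm (A u) + cnorm u)" if e: "e > 0" for e
    proof -
      have "openin (prod_topology hs.mtopology hs.mtopology) (hs.mball x e \<times> hs.mball y e)"
        by (simp add: openin_prod_Times_iff)
      moreover have "(x, y) \<in> hs.mball x e \<times> hs.mball y e" using x y e by simp
      ultimately have "\<exists>p. p \<in> (\<lambda>x. (x, A x)) ` D \<and> p \<in> hs.mball x e \<times> hs.mball y e"
        using xy[unfolded closure_graph_def in_closure_of, THEN conjunct2, rule_format,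
            of "hs.mball x e \<times> hs.mball y e"] by blast
      then obtain v where v: "v \<in> D" "(v, A v) \<in> hs.mball x e \<times> hs.mball y e"
        by (elim exE conjE imageE) simp
      have vH: "v \<in> H" "A v \<in> H" using v DH by auto
      have d: "cnorm (x - v) < e" "cnorm (A v - y) < e"
        using v vH x y by (auto simp: cdist_def cnorm_minus_commute)
      have "cinner (A u) v = cinner u (A v)"
        using S u v by (simp add: symmetric_operator_def)
      then have "cinner (A u) x - cinner u y = cinner (A u) (x - v) + cinner u (A v - y)"
        using uH vH x y by (simp add: cinner_diff_right)
      also have "norm \<dots> \<le> norm (cinner (A u) (x - v)) + norm (cinner u (A v - y))"
        by (rule norm_triangle_ineq)
      also have "\<dots> \<le> cnorm (A u) * cnorm (x - v) + cnorm u * cnorm (A v - y)"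
        using uH vH x y by (intro add_mono Cauchy_Schwarz) auto
      also have "\<dots> \<le> cnorm (A u) * e + cnorm u * e"
        using d uH by (intro add_mono mult_left_mono) (auto simp: cnorm_nonneg)
      finally show ?thesis by (simp add: algebra_simps)
    qed
    note le = this
    define K where "K = cnorm (A u) + cnorm u + 1"
    have K: "K > 0" using uH cnorm_nonneg by (simp add: K_def add_nonneg_pos)
    have "norm (cinner (A u) x - cinner u y) \<le> 0 + e" if e: "e > 0" for e
    proof -
      have "norm (cinner (A u) x - cinner u y) \<le> e / K * (cnorm (A u) + cnorm u)"
        using le[of "e / K"] e K by simp
      also have "\<dots> \<le> e / K * K" using e K by (intro mult_left_mono) (auto simp: K_def)
      finally show ?thesis using K by simp
    qed
    then have "norm (cinner (A u) x - cinner u y) \<le> 0" by (rule field_le_epsilon)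
    then show "cinner (A u) x = cinner u y" by simp
  qed
qed

lemma closure_unique:
  assumes "densely_defined D A" "symmetric_operator D A"
    and "(x, y) \<in> closure_graph D A" "(x, y') \<in> closure_graph D A"
  shows "y = y'"
  using adjoint_unique[of D A y x y'] closure_graph_adjoint[of D A] assms by blast

end

locale complex_hilbert_space = complex_inner_space +
  assumes complete: "hs.mcomplete"

definition square_dom :: "'a set \<Rightarrow> ('a \<Rightarrow> 'a) \<Rightarrow> 'a set" where
  "square_dom D A = {x \<in> D. A x \<in> D}"

end

theory Submission
  imports Defs
begin

text \<open>
  Take \<open>H = \<ell>\<^sup>2\<close> and let \<open>A\<close> multiply the \<open>k\<close>-th coordinate by \<open>k + 1\<close>, on the
  span \<open>D\<close> of the geometric sequences \<open>g\<^sub>t = (t\<^sup>k)\<^sub>k\<close> with \<open>0 < |t| < 1\<close> (in Hardy space terms, the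
  Szego kernels).  The sequences \<open>t\<^sup>k\<close> and \<open>k t\<^sup>k\<close> are linearly independent, so no nonzero element
  of \<open>D\<close> is mapped into \<open>D\<close>.  On the other hand \<open>t\<^sup>-\<^sup>j (g\<^sub>t - \<Sum>\<^sub>i\<^sub><\<^sub>j t\<^sup>i e\<^sub>i)\<close> tends to the unit vector
  \<open>e\<^sub>j\<close> as \<open>t \<rightarrow> 0\<close>, even after applying \<open>A\<close>; hence \<open>A D\<close> is dense.  Since the norm
  of \<open>x\<close> is at most that of \<open>A x\<close>, the closure of \<open>A\<close> is the multiplication operator on its
  maximal domain, which is self-adjoint.
\<close>

section \<open>Closures in inner product spaces\<close>

context complex_inner_space
begin

lemma in_closure_of_iff:
  assumes "S \<subseteq> H"
  shows "x \<in> hs.mtopology closure_of S \<longleftrightarrow> x \<in> H \<and> (\<forall>e>0. \<exists>y\<in>S. cnorm (x - y) < e)"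
proof -
  have "y \<in> hs.mball x e \<longleftrightarrow> cnorm (x - y) < e" if "x \<in> H" "y \<in> S" for y e
    using that assms by (auto simp: cdist_def)
  then show ?thesis by (auto simp: hs.metric_closure_of)
qed

lemma cnorm_scale: "x \<in> H \<Longrightarrow> cnorm (scale c x) = norm c * cnorm x"
proof -
  assume x: "x \<in> H"
  have "cinner (scale c x) (scale c x) = (c * cnj c) * cinner x x"
    using x by (simp add: cinner_scale_left cinner_scale_right)
  also have "\<dots> = of_real ((norm c * cnorm x)\<^sup>2)"
    using x unfolding complex_norm_square[symmetric]
    by (simp add: cinner_self power_mult_distrib)
  finally show ?thesis using x by (simp add: cnorm_def[of "scale c x"] cnorm_nonneg)
qed

lemma subspace_closure_of:
  assumes S: "subspace S" "S \<subseteq> H"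
  shows "subspace (hs.mtopology closure_of S)"
proof (rule subspaceI)
  show "0 \<in> hs.mtopology closure_of S"
    using S by (auto simp: in_closure_of_iff intro!: bexI[of _ 0] subspace_0 simp: cnorm_def)
next
  fix x y assume "x \<in> hs.mtopology closure_of S" "y \<in> hs.mtopology closure_of S"
  then have x: "x \<in> H" "\<And>e. e > 0 \<Longrightarrow> \<exists>u\<in>S. cnorm (x - u) < e"
    and y: "y \<in> H" "\<And>e. e > 0 \<Longrightarrow> \<exists>u\<in>S. cnorm (y - u) < e"
    using S by (auto simp: in_closure_of_iff)
  have "\<exists>w\<in>S. cnorm (x + y - w) < e" if e: "e > 0" for e
  proof -
    obtain u v where u: "u \<in> S" "cnorm (x - u) < e / 2" and v: "v \<in> S" "cnorm (y - v) < e / 2"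
      using x(2)[of "e / 2"] y(2)[of "e / 2"] e by auto
    have "cnorm (x + y - (u + v)) = cnorm ((x - u) + (y - v))" by (simp add: algebra_simps)
    also have "\<dots> \<le> cnorm (x - u) + cnorm (y - v)"
      using x y u v S by (intro cnorm_triangle) auto
    finally show ?thesis using u v S by (intro bexI[of _ "u + v"]) (auto intro: subspace_add)
  qed
  then show "x + y \<in> hs.mtopology closure_of S" using x y S by (simp add: in_closure_of_iff)
next
  fix c x assume "x \<in> hs.mtopology closure_of S"
  then have x: "x \<in> H" "\<And>e. e > 0 \<Longrightarrow> \<exists>u\<in>S. cnorm (x - u) < e"
    using S by (auto simp: in_closure_of_iff)
  have "\<exists>w\<in>S. cnorm (scale c x - w) < e" if e: "e > 0" for e
  proof -
    \<comment> \<open>Dividing by \<open>norm c + 1\<close> instead of \<open>norm c\<close> also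
      covers \<open>c = 0\<close>.\<close>
    have pos: "norm c + 1 > 0" by (simp add: add_nonneg_pos)
    then obtain u where u: "u \<in> S" "cnorm (x - u) < e / (norm c + 1)"
      using x(2)[of "e / (norm c + 1)"] e by auto
    have xu: "x - u \<in> H" using x u S by auto
    have "cnorm (scale c x - scale c u) = norm c * cnorm (x - u)"
      using cnorm_scale[OF xu] by (simp add: scale_right_diff_distrib)
    also have "\<dots> \<le> (norm c + 1) * cnorm (x - u)"
      using cnorm_nonneg[OF xu] by (intro mult_right_mono) auto
    also have "\<dots> < e" using u pos by (simp add: field_simps)
    finally show ?thesis using u S by (intro bexI[of _ "scale c u"]) (auto intro: subspace_scale)
  qed
  then show "scale c x \<in> hs.mtopology closure_of S" using x S by (simp add: in_closure_of_iff)
qed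

lemma closure_graphI:
  assumes xy: "x \<in> H" "y \<in> H" and A: "D \<subseteq> H" "\<And>u. u \<in> D \<Longrightarrow> A u \<in> H"
    and appr: "\<And>e. e > 0 \<Longrightarrow> \<exists>u\<in>D. cnorm (x - u) < e \<and> cnorm (y - A u) < e"
  shows "(x, y) \<in> closure_graph D A"
  unfolding closure_graph_def in_closure_of
proof (intro conjI allI impI)
  show "(x, y) \<in> topspace (prod_topology hs.mtopology hs.mtopology)" using xy by simp
next
  fix T assume "(x, y) \<in> T \<and> openin (prod_topology hs.mtopology hs.mtopology) T"
  then obtain U V where UV: "openin hs.mtopology U" "openin hs.mtopology V" "x \<in> U" "y \<in> V"
      "U \<times> V \<subseteq> T"
    unfolding openin_prod_topology_alt by blast
  then obtain r s where r: "r > 0" "hs.mball x r \<subseteq> U" and s: "s > 0" "hs.mball y s \<subseteq> V"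
    unfolding hs.openin_mtopology by blast
  obtain u where u: "u \<in> D" "cnorm (x - u) < min r s" "cnorm (y - A u) < min r s"
    using appr[of "min r s"] r s by auto
  have "u \<in> hs.mball x r" "A u \<in> hs.mball y s" using u xy A by (auto simp: cdist_def)
  then show "\<exists>p. p \<in> (\<lambda>x. (x, A x)) ` D \<and> p \<in> T" using u(1) r s UV by blast
qed

text \<open>Every notion involved looks at the operator on \<open>D\<close> only. This matters
  because \<open>closure_op\<close> is a definite description whose value is controlled only on the
  domain of the closure.\<close>

lemma self_adjoint_cong:
  assumes "self_adjoint D A" "\<And>x. x \<in> D \<Longrightarrow> B x = A x"
  shows "self_adjoint D B"
proof -
  have ad: "adjoint_dom D B = adjoint_dom D A" "adjoint_op D B = adjoint_op D A"
    using assms(2) by (simp_all add: adjoint_dom_def adjoint_op_def[abs_def] cong: ball_cong)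
  have sub: "subspace D"
    using assms(1) by (simp add: self_adjoint_def densely_defined_def linear_operator_def)
  have "linear_operator D B"
    using assms sub subspace_add[OF sub] subspace_scale[OF sub]
    by (simp add: self_adjoint_def densely_defined_def linear_operator_def)
  then show ?thesis using assms ad by (simp add: self_adjoint_def densely_defined_def)
qed

end

section \<open>The space of square-summable sequences\<close>

definition scl :: "complex \<Rightarrow> (nat \<Rightarrow> complex) \<Rightarrow> nat \<Rightarrow> complex" where
  "scl c x = (\<lambda>k. c * x k)"

definition l2 :: "(nat \<Rightarrow> complex) set" where
  "l2 = {x. summable (\<lambda>k. (cmod (x k))\<^sup>2)}"

definition ip :: "(nat \<Rightarrow> complex) \<Rightarrow> (nat \<Rightarrow> complex) \<Rightarrow> complex" where
  "ip x y = (\<Sum>k. x k * cnj (y k))"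

lemma scl_apply [simp]: "scl c x k = c * x k"
  by (simp add: scl_def)

lemma vector_space_scl: "vector_space scl"
  by standard (auto simp: scl_def fun_eq_iff algebra_simps)

lemma l2_bounded_by:
  assumes "y \<in> l2" "\<And>k. cmod (x k) \<le> cmod (y k)"
  shows "x \<in> l2"
  using assms unfolding l2_def mem_Collect_eq
  by (elim summable_comparison_test'[where N = 0]) (auto intro: power_mono)

lemma l2_add:
  assumes "x \<in> l2" "y \<in> l2"
  shows "x + y \<in> l2"
proof -
  have "(cmod (x k + y k))\<^sup>2 \<le> 2 * (cmod (x k))\<^sup>2 + 2 * (cmod (y k))\<^sup>2" for k
  proof -
    have "(cmod (x k + y k))\<^sup>2 \<le> (cmod (x k) + cmod (y k))\<^sup>2"
      by (intro power_mono norm_triangle_ineq) simp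
    also have "\<dots> \<le> 2 * (cmod (x k))\<^sup>2 + 2 * (cmod (y k))\<^sup>2"
      using sum_squares_bound[of "cmod (x k)" "cmod (y k)"] by (simp add: power2_sum)
    finally show ?thesis .
  qed
  moreover have "summable (\<lambda>k. 2 * (cmod (x k))\<^sup>2 + 2 * (cmod (y k))\<^sup>2)"
    using assms by (intro summable_add summable_mult) (auto simp: l2_def)
  ultimately have "summable (\<lambda>k. (cmod ((x + y) k))\<^sup>2)"
    by (auto intro: summable_comparison_test'[where N = 0
          and g = "\<lambda>k. 2 * (cmod (x k))\<^sup>2 + 2 * (cmod (y k))\<^sup>2"])
  then show ?thesis by (simp add: l2_def)
qed

lemma l2_scl: "x \<in> l2 \<Longrightarrow> scl c x \<in> l2"
  unfolding l2_def by (simp add: norm_mult power_mult_distrib summable_mult)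

lemma summable_ip:
  assumes "x \<in> l2" "y \<in> l2"
  shows "summable (\<lambda>k. x k * cnj (y k))"
proof (rule summable_comparison_test'[where N = 0])
  show "summable (\<lambda>k. (cmod (x k))\<^sup>2 + (cmod (y k))\<^sup>2)"
    using assms by (intro summable_add) (auto simp: l2_def)
  show "norm (x k * cnj (y k)) \<le> (cmod (x k))\<^sup>2 + (cmod (y k))\<^sup>2" for k
    using sum_squares_bound[of "cmod (x k)" "cmod (y k)"]
      mult_nonneg_nonneg[OF norm_ge_zero[of "x k"] norm_ge_zero[of "y k"]]
    unfolding norm_mult complex_mod_cnj by linarith
qed

lemma ip_self: "x \<in> l2 \<Longrightarrow> ip x x = of_real (\<Sum>k. (cmod (x k))\<^sup>2)"
proof -
  assume "x \<in> l2"
  then have "(\<lambda>k. (cmod (x k))\<^sup>2) sums (\<Sum>k. (cmod (x k))\<^sup>2)"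
    by (simp add: l2_def summable_sums)
  then have "(\<lambda>k. of_real ((cmod (x k))\<^sup>2) :: complex) sums of_real (\<Sum>k. (cmod (x k))\<^sup>2)"
    by (rule sums_of_real)
  then show ?thesis
    unfolding ip_def complex_norm_square by (rule sums_unique[symmetric])
qed

interpretation l2: complex_inner_space scl l2 ip
proof (rule complex_inner_space.intro[OF vector_space_scl], unfold_locales)
  interpret vector_space scl by (rule vector_space_scl)
  show "module.subspace scl l2"
    by (rule subspaceI) (auto simp: l2_add l2_scl, simp add: l2_def)
  show "ip (x + y) z = ip x z + ip y z" if "x \<in> l2" "y \<in> l2" "z \<in> l2" for x y z
    unfolding ip_def using suminf_add[OF summable_ip[of x z] summable_ip[of y z]] that
    by (simp add: algebra_simps)
  show "ip (scl c x) y = c * ip x y" if "x \<in> l2" "y \<in> l2" for c x y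
    unfolding ip_def using suminf_mult[OF summable_ip[OF that], of c]
    by (simp add: mult.assoc)
  show "ip x y = cnj (ip y x)" if "x \<in> l2" "y \<in> l2" for x y
  proof -
    have "(\<lambda>k. cnj (y k * cnj (x k))) sums cnj (ip y x)"
      unfolding ip_def sums_cnj using summable_ip[OF that(2,1)] by (rule summable_sums)
    then show ?thesis unfolding ip_def by (simp add: sums_iff mult.commute)
  qed
  show "0 < Re (ip x x)" if x: "x \<in> l2" "x \<noteq> 0" for x
  proof -
    obtain k where k: "x k \<noteq> 0" using x(2) by (auto simp: fun_eq_iff)
    have "0 < (cmod (x k))\<^sup>2" using k by simp
    then have "0 < (\<Sum>k. (cmod (x k))\<^sup>2)"
      using x by (intro suminf_pos2[of _ k]) (auto simp: l2_def)
    then show ?thesis using x by (simp add: ip_self)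
  qed
qed

lemma l2_norm_eq: "x \<in> l2 \<Longrightarrow> l2.cnorm x = sqrt (\<Sum>k. (cmod (x k))\<^sup>2)"
  by (simp add: l2.cnorm_def ip_self)

lemma l2_norm_mono:
  assumes "y \<in> l2" "\<And>k. cmod (x k) \<le> cmod (y k)"
  shows "l2.cnorm x \<le> l2.cnorm y"
proof -
  have x: "x \<in> l2" using assms by (rule l2_bounded_by)
  then show ?thesis
    unfolding l2_norm_eq[OF x] l2_norm_eq[OF assms(1)] using assms
    by (intro real_sqrt_le_mono suminf_le power_mono) (auto simp: l2_def)
qed

lemma sum_le_l2_norm:
  assumes "x \<in> l2" shows "(\<Sum>k<n. (cmod (x k))\<^sup>2) \<le> (l2.cnorm x)\<^sup>2"
proof -
  have "0 \<le> (\<Sum>k. (cmod (x k))\<^sup>2)" using assms by (intro suminf_nonneg) (auto simp: l2_def)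
  then show ?thesis unfolding l2_norm_eq[OF assms]
    using assms by (auto simp: l2_def intro!: sum_le_suminf)
qed

text \<open>A uniform bound on partial sums gives membership and norm bound at once, so it suits
  sequences not yet known to be square-summable, such as coordinatewise limits.\<close>

lemma l2_normI:
  assumes "\<And>n. (\<Sum>k<n. (cmod (x k))\<^sup>2) \<le> B\<^sup>2" "B \<ge> 0"
  shows "x \<in> l2" "l2.cnorm x \<le> B"
proof -
  show x: "x \<in> l2" unfolding l2_def mem_Collect_eq
    using assms by (intro summableI_nonneg_bounded[where x = "B\<^sup>2"]) auto
  then have "(\<Sum>k. (cmod (x k))\<^sup>2) \<le> B\<^sup>2"
    using assms by (intro suminf_le_const) (auto simp: l2_def)
  then have "sqrt (\<Sum>k. (cmod (x k))\<^sup>2) \<le> sqrt (B\<^sup>2)" by (rule real_sqrt_le_mono)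
  then show "l2.cnorm x \<le> B" using assms x by (simp add: l2_norm_eq)
qed

section \<open>Completeness of \<open>l2\<close>\<close>

lemma l2_norm_coord: "x \<in> l2 \<Longrightarrow> cmod (x k) \<le> l2.cnorm x"
proof -
  assume x: "x \<in> l2"
  have "(cmod (x k))\<^sup>2 \<le> (\<Sum>j<Suc k. (cmod (x j))\<^sup>2)"
    by (intro member_le_sum) auto
  also have "\<dots> \<le> (l2.cnorm x)\<^sup>2" using x by (rule sum_le_l2_norm)
  finally show ?thesis using l2.cnorm_nonneg[OF x] by (rule power2_le_imp_le)
qed

text \<open>Coordinates are dominated by the norm, so a Cauchy sequence converges coordinatewise.
  The Cauchy estimate survives the limit on every finite block of coordinates, hence in
  norm.\<close>

lemma mcomplete_l2: "l2.hs.mcomplete"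
  unfolding l2.hs.mcomplete_def
proof (intro allI impI)
  fix \<sigma> assume \<sigma>: "l2.hs.MCauchy \<sigma>"
  have \<sigma>l: "\<sigma> n \<in> l2" for n using \<sigma> by (auto simp: l2.hs.MCauchy_def)
  have C: "\<exists>N. \<forall>n n'. N \<le> n \<longrightarrow> N \<le> n' \<longrightarrow> l2.cnorm (\<sigma> n - \<sigma> n') < e" if "e > 0" for e
    using \<sigma> that \<sigma>l by (auto simp: l2.hs.MCauchy_def l2.cdist_def)
  have "Cauchy (\<lambda>n. \<sigma> n k)" for k
  proof (rule CauchyI)
    fix e :: real assume "e > 0"
    then obtain N where "\<forall>n n'. N \<le> n \<longrightarrow> N \<le> n' \<longrightarrow> l2.cnorm (\<sigma> n - \<sigma> n') < e"
      using C by blast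
    moreover have "cmod (\<sigma> n k - \<sigma> n' k) \<le> l2.cnorm (\<sigma> n - \<sigma> n')" for n n'
      using l2_norm_coord[of "\<sigma> n - \<sigma> n'" k] \<sigma>l by simp
    ultimately show "\<exists>M. \<forall>m\<ge>M. \<forall>n\<ge>M. norm (\<sigma> m k - \<sigma> n k) < e"
      by (meson le_less_trans)
  qed
  then have "\<forall>k. \<exists>l. (\<lambda>n. \<sigma> n k) \<longlonglongrightarrow> l"
    by (simp add: Cauchy_convergent_iff convergent_def)
  then obtain x where x: "\<And>k. (\<lambda>n. \<sigma> n k) \<longlonglongrightarrow> x k" by metis
  have appr: "\<exists>N. \<forall>n\<ge>N. x - \<sigma> n \<in> l2 \<and> l2.cnorm (x - \<sigma> n) \<le> e" if e: "e > 0" for e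
  proof -
    obtain N where N: "\<And>n n'. \<lbrakk>N \<le> n; N \<le> n'\<rbrakk> \<Longrightarrow> l2.cnorm (\<sigma> n - \<sigma> n') < e"
      using C[OF e] by blast
    \<comment> \<open>With \<open>K\<close> and \<open>n\<close> fixed, let \<open>m\<close> tend to
      infinity; the sum is finite, so coordinatewise limits suffice.\<close>
    have "(\<Sum>k<K. (cmod ((x - \<sigma> n) k))\<^sup>2) \<le> e\<^sup>2" if n: "n \<ge> N" for n K
    proof (rule tendsto_upperbound)
      show "(\<lambda>m. \<Sum>k<K. (cmod (\<sigma> m k - \<sigma> n k))\<^sup>2) \<longlonglongrightarrow> (\<Sum>k<K. (cmod ((x - \<sigma> n) k))\<^sup>2)"
        unfolding minus_apply by (intro tendsto_intros x)
      have "(\<Sum>k<K. (cmod (\<sigma> m k - \<sigma> n k))\<^sup>2) \<le> e\<^sup>2" if m: "m \<ge> N" for m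
      proof -
        have "(\<Sum>k<K. (cmod (\<sigma> m k - \<sigma> n k))\<^sup>2) \<le> (l2.cnorm (\<sigma> m - \<sigma> n))\<^sup>2"
          using sum_le_l2_norm[of "\<sigma> m - \<sigma> n" K] \<sigma>l by simp
        also have "\<dots> \<le> e\<^sup>2"
          using N[OF m n] \<sigma>l by (intro power_mono l2.cnorm_nonneg) auto
        finally show ?thesis .
      qed
      then show "\<forall>\<^sub>F m in sequentially. (\<Sum>k<K. (cmod (\<sigma> m k - \<sigma> n k))\<^sup>2) \<le> e\<^sup>2"
        by (auto simp: eventually_sequentially)
    qed simp
    then show ?thesis using l2_normI e by (metis less_imp_le)
  qed
  obtain n where "x - \<sigma> n \<in> l2" using appr[of 1] by auto
  then have xl: "x \<in> l2" using l2.H_closed(2)[of "x - \<sigma> n" "\<sigma> n"] \<sigma>l by simp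
  have "limitin l2.hs.mtopology \<sigma> x sequentially"
    unfolding l2.hs.limitin_metric eventually_sequentially
  proof (intro conjI allI impI xl)
    fix e :: real assume e: "e > 0"
    \<comment> \<open>Half of \<open>e\<close>, since \<open>appr\<close> yields a non-strict bound
      and convergence asks for a strict one.\<close>
    obtain N where "\<forall>n\<ge>N. l2.cnorm (x - \<sigma> n) \<le> e / 2" using appr[of "e / 2"] e by auto
    then have "\<forall>n\<ge>N. \<sigma> n \<in> l2 \<and> l2.cdist (\<sigma> n) x < e"
      using e \<sigma>l xl by (auto simp: l2.cdist_def l2.cnorm_minus_commute[OF _ xl] intro: le_less_trans)
    then show "\<exists>N. \<forall>n\<ge>N. \<sigma> n \<in> l2 \<and> l2.cdist (\<sigma> n) x < e" by blast
  qed
  then show "\<exists>x. limitin l2.hs.mtopology \<sigma> x sequentially" by blast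
qed

lemma complex_hilbert_space_l2: "complex_hilbert_space scl l2 ip"
  by unfold_locales (rule mcomplete_l2)

section \<open>Unit sequences and a density criterion\<close>

definition unit_seq :: "nat \<Rightarrow> nat \<Rightarrow> complex" where
  "unit_seq j = (\<lambda>k. if k = j then 1 else 0)"

lemma unit_seq_l2: "unit_seq j \<in> l2"
proof -
  have "summable (\<lambda>k. (cmod (unit_seq j k))\<^sup>2)"
    by (rule summable_finite[of "{j}"]) (auto simp: unit_seq_def)
  then show ?thesis by (simp add: l2_def)
qed

lemma ip_unit_seq: "ip (unit_seq j) x = cnj (x j)"
proof -
  have "(\<Sum>k. unit_seq j k * cnj (x k)) = (\<Sum>k\<in>{j}. unit_seq j k * cnj (x k))"
    by (rule suminf_finite) (auto simp: unit_seq_def)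
  then show ?thesis by (simp add: ip_def unit_seq_def)
qed

lemma sum_unit_seq_apply: "(\<Sum>j<n. scl (c j) (unit_seq j)) k = (if k < n then c k else 0)"
proof -
  have "(\<Sum>j<n. scl (c j) (unit_seq j)) k = (\<Sum>j<n. scl (c j) (unit_seq j) k)"
    by (induction n) auto
  also have "\<dots> = (\<Sum>j<n. if k = j then c j else 0)"
    by (intro sum.cong) (auto simp: unit_seq_def)
  finally show ?thesis by simp
qed

text \<open>The closure is a subspace, so it contains all finite truncations of a sequence; these
  converge in norm, and the closure is closed.\<close>

lemma subspace_dense_if_unit_seqs:
  assumes S: "l2.subspace S" "S \<subseteq> l2"
    and unit: "\<And>j. unit_seq j \<in> l2.hs.mtopology closure_of S"
  shows "l2.hs.mtopology closure_of S = l2"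
proof
  let ?K = "l2.hs.mtopology closure_of S"
  show KH: "?K \<subseteq> l2" using S by (auto simp: l2.in_closure_of_iff)
  have K: "l2.subspace ?K" using S by (rule l2.subspace_closure_of)
  show "l2 \<subseteq> ?K"
  proof
    fix x assume x: "x \<in> l2"
    have "\<exists>y\<in>?K. l2.cnorm (x - y) < e" if e: "e > 0" for e
    proof -
      have "summable (\<lambda>k. (cmod (x k))\<^sup>2)" using x by (simp add: l2_def)
      then obtain N where N: "\<And>n. n \<ge> N \<Longrightarrow> norm (\<Sum>k. (cmod (x (k + n)))\<^sup>2) < (e / 2)\<^sup>2"
        using suminf_exist_split[of "(e / 2)\<^sup>2" "\<lambda>k. (cmod (x k))\<^sup>2"] e by auto
      define y where "y = (\<Sum>j<N. scl (x j) (unit_seq j))"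
      have y: "y \<in> ?K"
        unfolding y_def using unit K by (intro l2.subspace_sum l2.subspace_scale) auto
      have "(\<Sum>k<n. (cmod ((x - y) k))\<^sup>2) \<le> (e / 2)\<^sup>2" for n
      proof -
        \<comment> \<open>Lengthening the sum by \<open>N\<close> terms makes it reach past the cut;
          the first \<open>N\<close> terms vanish and the other \<open>n\<close> are an initial
          piece of the tail.\<close>
        have "(\<Sum>k<n. (cmod ((x - y) k))\<^sup>2) \<le> (\<Sum>k<n + N. (cmod ((x - y) k))\<^sup>2)"
          by (intro sum_mono2) auto
        also have "\<dots> = (\<Sum>k\<in>{N..<n + N}. (cmod (x k))\<^sup>2)"
          by (intro sum.mono_neutral_cong_right) (auto simp: y_def sum_unit_seq_apply)
        also have "\<dots> = (\<Sum>k<n. (cmod (x (k + N)))\<^sup>2)"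
          using sum.shift_bounds_nat_ivl[of "\<lambda>k. (cmod (x k))\<^sup>2" 0 N n]
          by (simp add: lessThan_atLeast0)
        also have "\<dots> \<le> (\<Sum>k. (cmod (x (k + N)))\<^sup>2)"
          using x by (intro sum_le_suminf) (auto simp: l2_def summable_iff_shift[of "\<lambda>k. (cmod (x k))\<^sup>2"])
        also have "\<dots> \<le> (e / 2)\<^sup>2" using N[of N] by simp
        finally show ?thesis .
      qed
      then have "l2.cnorm (x - y) \<le> e / 2" using e by (intro l2_normI) auto
      then show ?thesis using y e by (intro bexI[of _ y]) auto
    qed
    then have "x \<in> l2.hs.mtopology closure_of ?K"
      using x by (intro iffD2[OF l2.in_closure_of_iff[OF KH]]) blast
    then show "x \<in> ?K" by simp
  qed
qed

section \<open>Multiplication by the index\<close>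

text \<open>The factor \<open>Suc k\<close>, unlike \<open>k\<close>, is at least 1 throughout, so
  the operator never decreases norms (\<open>l2_norm_le_mul\<close>).\<close>

definition mul :: "(nat \<Rightarrow> complex) \<Rightarrow> nat \<Rightarrow> complex" where
  "mul x = (\<lambda>k. of_nat (Suc k) * x k)"

text \<open>The maximal domain of the multiplication operator; its elements lie in \<open>l2\<close>
  by \<open>cmod_le_mul\<close>.\<close>

definition mul_dom :: "(nat \<Rightarrow> complex) set" where
  "mul_dom = {x. mul x \<in> l2}"

lemma mul_add: "mul (x + y) = mul x + mul y"
  and mul_diff: "mul (x - y) = mul x - mul y"
  and mul_scl: "mul (scl c x) = scl c (mul x)"
  and mul_zero: "mul 0 = 0"
  by (auto simp: mul_def fun_eq_iff algebra_simps simp del: of_nat_Suc)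

lemma mul_sum: "mul (sum f I) = (\<Sum>i\<in>I. mul (f i))"
  by (induction I rule: infinite_finite_induct) (simp_all only: mul_zero mul_add sum.infinite sum.empty sum.insert not_False_eq_True)

lemma mul_unit_seq: "mul (unit_seq j) = scl (of_nat (Suc j)) (unit_seq j)"
  by (auto simp: mul_def unit_seq_def fun_eq_iff)

lemma cmod_le_mul: "cmod (x k) \<le> cmod (mul x k)"
proof -
  have "1 * cmod (x k) \<le> real (Suc k) * cmod (x k)" by (intro mult_right_mono) auto
  then show ?thesis by (simp add: mul_def norm_mult del: of_nat_Suc)
qed

lemma mul_dom_l2: "x \<in> mul_dom \<Longrightarrow> x \<in> l2"
  unfolding mul_dom_def using cmod_le_mul by (auto intro: l2_bounded_by)

lemma mul_l2: "x \<in> mul_dom \<Longrightarrow> mul x \<in> l2"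
  by (simp add: mul_dom_def)

lemma l2_norm_le_mul: "x \<in> mul_dom \<Longrightarrow> l2.cnorm x \<le> l2.cnorm (mul x)"
  unfolding mul_dom_def using cmod_le_mul by (auto intro: l2_norm_mono)

lemma subspace_mul_dom: "l2.subspace mul_dom"
  by (rule l2.subspaceI) (auto simp: mul_dom_def mul_add mul_scl mul_zero l2_add l2_scl)

lemma unit_seq_mul_dom: "unit_seq j \<in> mul_dom"
  by (simp add: mul_dom_def mul_unit_seq unit_seq_l2)

text \<open>The weights are real, so both sides are the same series term by term.\<close>

lemma ip_mul: "ip (mul x) y = ip x (mul y)"
  by (simp add: ip_def mul_def mult_ac)

section \<open>Self-adjointness on the maximal domain\<close>

lemma linear_operator_mul:
  "l2.subspace D \<Longrightarrow> D \<subseteq> mul_dom \<Longrightarrow> l2.linear_operator D mul"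
  unfolding l2.linear_operator_def using mul_dom_l2 mul_l2
  by (auto simp: mul_add mul_scl)

text \<open>Testing with unit sequences reads off each coordinate. This identifies the adjoint and,
  later, the limits of the graph.\<close>

lemma adjoint_mul:
  assumes "\<forall>x\<in>mul_dom. ip (mul x) y = ip x z"
  shows "z = mul y"
proof
  fix j
  have "ip (unit_seq j) (mul y) = ip (unit_seq j) z"
    using assms unit_seq_mul_dom[of j] by (simp add: ip_mul)
  then show "z j = mul y j" by (simp add: ip_unit_seq)
qed

text \<open>The adjoint cannot have a larger domain: its value at \<open>y\<close> must be
  \<open>mul y\<close>, and requiring this to be in \<open>l2\<close> is the definition of
  \<open>mul_dom\<close>.\<close>

lemma self_adjoint_mul: "l2.self_adjoint mul_dom mul"
proof -
  have dense: "l2.hs.mtopology closure_of mul_dom = l2"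
  proof (rule subspace_dense_if_unit_seqs[OF subspace_mul_dom])
    show "mul_dom \<subseteq> l2" using mul_dom_l2 by blast
    then show "unit_seq j \<in> l2.hs.mtopology closure_of mul_dom" for j
      using closure_of_subset[of mul_dom l2.hs.mtopology] unit_seq_mul_dom by auto
  qed
  have dd: "l2.densely_defined mul_dom mul"
    using linear_operator_mul[OF subspace_mul_dom] dense by (simp add: l2.densely_defined_def)
  have "y \<in> l2.adjoint_dom mul_dom mul \<longleftrightarrow> y \<in> mul_dom" for y
  proof
    assume "y \<in> l2.adjoint_dom mul_dom mul"
    then obtain z where z: "z \<in> l2" "\<forall>x\<in>mul_dom. ip (mul x) y = ip x z"
      by (auto simp: l2.adjoint_dom_def)
    show "y \<in> mul_dom" using z(1) adjoint_mul[OF z(2)] by (simp add: mul_dom_def)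
  next
    assume "y \<in> mul_dom"
    then have "y \<in> l2" "mul y \<in> l2" by (simp_all add: mul_dom_l2 mul_l2)
    then show "y \<in> l2.adjoint_dom mul_dom mul"
      unfolding l2.adjoint_dom_def by (auto simp: ip_mul intro!: bexI[of _ "mul y"])
  qed
  then have "l2.adjoint_dom mul_dom mul = mul_dom" by blast
  moreover have "l2.adjoint_op mul_dom mul y = mul y" if "y \<in> mul_dom" for y
    unfolding l2.adjoint_op_def
  proof (rule the_equality)
    show "mul y \<in> l2 \<and> (\<forall>x\<in>mul_dom. ip (mul x) y = ip x (mul y))"
      using that by (simp add: ip_mul mul_dom_def)
  qed (blast intro: adjoint_mul)
  ultimately show ?thesis using dd by (simp add: l2.self_adjoint_def)
qed

section \<open>Essential self-adjointness on a smaller domain\<close>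

lemma subspace_image_mul:
  assumes "l2.subspace D"
  shows "l2.subspace (mul ` D)"
proof (rule l2.subspaceI)
  show "0 \<in> mul ` D" using l2.subspace_0[OF assms] mul_zero by (metis image_eqI)
  show "x + y \<in> mul ` D" if "x \<in> mul ` D" "y \<in> mul ` D" for x y
    using that l2.subspace_add[OF assms] by (auto simp flip: mul_add)
  show "scl c x \<in> mul ` D" if "x \<in> mul ` D" for c x
    using that l2.subspace_scale[OF assms] by (auto simp flip: mul_scl)
qed

text \<open>Dense range makes \<open>D\<close> a core: if \<open>mul u\<close> is close to
  \<open>mul x\<close>, then \<open>u\<close> is at least as close to \<open>x\<close>, so the graph
  over \<open>D\<close> is dense in the graph over \<open>mul_dom\<close>.\<close>

lemma essentially_self_adjoint_mul:
  assumes D: "l2.subspace D" "D \<subseteq> mul_dom"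
    and range: "\<And>j. unit_seq j \<in> l2.hs.mtopology closure_of (mul ` D)"
  shows "l2.essentially_self_adjoint D mul"
proof -
  have Dl: "D \<subseteq> l2" "mul ` D \<subseteq> l2" using D mul_dom_l2 mul_l2 by auto
  have lin: "l2.linear_operator D mul" using D by (rule linear_operator_mul)
  have range_dense: "l2.hs.mtopology closure_of (mul ` D) = l2"
    using subspace_image_mul[OF D(1)] Dl(2) range by (rule subspace_dense_if_unit_seqs)
  have appr: "\<exists>u\<in>D. l2.cnorm (x - u) < e \<and> l2.cnorm (mul x - mul u) < e"
    if x: "x \<in> mul_dom" and e: "e > 0" for x e
  proof -
    have "mul x \<in> l2.hs.mtopology closure_of (mul ` D)"
      using x range_dense by (simp add: mul_dom_def)
    then obtain u where u: "u \<in> D" "l2.cnorm (mul x - mul u) < e"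
      using e Dl(2) by (auto simp: l2.in_closure_of_iff)
    have "x - u \<in> mul_dom" using x u D by (auto intro: l2.subspace_diff[OF subspace_mul_dom])
    then have "l2.cnorm (x - u) \<le> l2.cnorm (mul x - mul u)"
      using l2_norm_le_mul by (simp flip: mul_diff)
    then show ?thesis using u by (intro bexI[of _ u] conjI) auto
  qed
  \<comment> \<open>Density of \<open>D\<close> itself comes from the first half of the same
    approximation.\<close>
  have "unit_seq j \<in> l2.hs.mtopology closure_of D" for j
    using appr[OF unit_seq_mul_dom] Dl unit_seq_l2 by (auto simp: l2.in_closure_of_iff) blast
  then have dd: "l2.densely_defined D mul"
    using lin subspace_dense_if_unit_seqs[OF D(1) Dl(1)] by (simp add: l2.densely_defined_def)
  have sym: "l2.symmetric_operator D mul" by (simp add: l2.symmetric_operator_def ip_mul)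
  have graph: "l2.closure_graph D mul = (\<lambda>x. (x, mul x)) ` mul_dom"
  proof (intro equalityI subsetI)
    fix p assume p: "p \<in> l2.closure_graph D mul"
    \<comment> \<open>Passing to \<open>mul_dom\<close> provides the unit sequences as test vectors
      for \<open>adjoint_mul\<close>; \<open>D\<close> need not contain them.\<close>
    then have "p \<in> l2.closure_graph mul_dom mul"
      unfolding l2.closure_graph_def
      using closure_of_mono[OF image_mono[OF D(2)]] by (rule subsetD[rotated])
    moreover obtain x y where xy: "p = (x, y)" by (cases p)
    ultimately have y: "y \<in> l2" and adj: "\<forall>u\<in>mul_dom. ip (mul u) x = ip u y"
      using l2.closure_graph_adjoint[of mul_dom mul x y] self_adjoint_mul
      by (auto simp: l2.self_adjoint_def l2.symmetric_operator_def ip_mul)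
    from adj have "y = mul x" by (rule adjoint_mul)
    then show "p \<in> (\<lambda>x. (x, mul x)) ` mul_dom" using xy y by (auto simp: mul_dom_def)
  next
    fix p assume "p \<in> (\<lambda>x. (x, mul x)) ` mul_dom"
    then obtain x where x: "x \<in> mul_dom" "p = (x, mul x)" by blast
    have "(x, mul x) \<in> l2.closure_graph D mul"
      using appr[OF x(1)] Dl mul_dom_l2[OF x(1)] mul_l2[OF x(1)]
      by (intro l2.closure_graphI) auto
    then show "p \<in> l2.closure_graph D mul" using x by simp
  qed
  have dom: "l2.closure_dom D mul = mul_dom"
    by (auto simp: l2.closure_dom_def graph image_image)
  have "l2.closure_op D mul x = mul x" if "x \<in> mul_dom" for x
    unfolding l2.closure_op_def graph using that by (intro the_equality) auto
  then have "l2.self_adjoint mul_dom (l2.closure_op D mul)"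
    by (intro l2.self_adjoint_cong[OF self_adjoint_mul]) auto
  then show ?thesis using dd sym dom by (simp add: l2.essentially_self_adjoint_def)
qed

section \<open>Geometric sequences\<close>

text \<open>Pairing the relation with the polynomial \<open>(X - s) \<Prod>\<^sub>t (X - t)\<^sup>2\<close>, where \<open>t\<close> runs over
  the other bases, isolates the coefficient \<open>c s\<close>.\<close>

lemma geometric_independent:
  fixes c d :: "complex \<Rightarrow> complex"
  assumes T: "finite T"
    and rel: "\<And>k. (\<Sum>t\<in>T. (of_nat (Suc k) * c t + d t) * t ^ k) = 0"
    and s: "s \<in> T" "s \<noteq> 0"
  shows "c s = 0"
proof -
  \<comment> \<open>Combine the relations \<open>rel\<close> with the coefficients of
    \<open>p\<close> as weights. The weights \<open>(i + 1) * coeff p i\<close> belong to the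
    derivative of \<open>X p\<close>, which is \<open>p + X p'\<close>.\<close>
  have pairing: "(\<Sum>t\<in>T. c t * poly (p + pCons 0 (pderiv p)) t + d t * poly p t) = 0" for p
  proof -
    let ?N = "Suc (degree p)"
    have ev: "poly q t = (\<Sum>i\<le>?N. coeff q i * t ^ i)" if "degree q \<le> ?N" for q and t :: complex
      unfolding poly_altdef using that
      by (intro sum.mono_neutral_left) (auto simp: coeff_eq_0)
    have p: "poly p t = (\<Sum>i\<le>?N. coeff p i * t ^ i)" for t by (rule ev) simp
    have "degree (pderiv (pCons 0 p)) \<le> ?N"
      using degree_pCons_le[of 0 p] by (simp add: degree_pderiv)
    then have p': "poly (p + pCons 0 (pderiv p)) t
        = (\<Sum>i\<le>?N. of_nat (Suc i) * coeff p i * t ^ i)" for t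
      using ev[of "pderiv (pCons 0 p)" t]
      by (simp only: pderiv_pCons[of 0 p, symmetric] coeff_pderiv coeff_pCons_Suc)
    have "(\<Sum>t\<in>T. c t * poly (p + pCons 0 (pderiv p)) t + d t * poly p t)
        = (\<Sum>t\<in>T. \<Sum>i\<le>?N. coeff p i * ((of_nat (Suc i) * c t + d t) * t ^ i))"
      unfolding p p' sum_distrib_left sum.distrib[symmetric]
      by (intro sum.cong refl) (simp add: algebra_simps)
    also have "\<dots> = (\<Sum>i\<le>?N. coeff p i * (\<Sum>t\<in>T. (of_nat (Suc i) * c t + d t) * t ^ i))"
      by (subst sum.swap) (simp only: sum_distrib_left)
    also have "\<dots> = 0" by (simp only: rel mult_zero_right sum.neutral_const)
    finally show ?thesis .
  qed
  define q where "q = (\<Prod>t\<in>T - {s}. [:- t, 1:]\<^sup>2)"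
  define p where "p = [:- s, 1:] * q"
  have p's: "poly (pderiv p) s = poly q s"
    unfolding p_def pderiv_mult poly_add poly_mult by (simp add: pderiv_pCons)
  \<comment> \<open>A double zero at \<open>t\<close> annihilates both \<open>p\<close> and its
    derivative, hence the terms of \<open>c t\<close> and \<open>d t\<close> together.\<close>
  have zero: "poly p t = 0 \<and> poly (pderiv p) t = 0" if t: "t \<in> T" "t \<noteq> s" for t
  proof -
    have "[:- t, 1:]\<^sup>2 dvd q" unfolding q_def using t T by (intro dvd_prodI) auto
    then have "[:- t, 1:]\<^sup>2 dvd p" unfolding p_def by (rule dvd_mult)
    then obtain r where r: "p = [:- t, 1:] * ([:- t, 1:] * r)"
      by (metis dvdE mult.assoc power2_eq_square)
    show ?thesis unfolding r pderiv_mult poly_add poly_mult by simp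
  qed
  have qs: "poly q s \<noteq> 0" using T by (auto simp: q_def poly_prod)
  have "0 = (\<Sum>t\<in>T. c t * poly (p + pCons 0 (pderiv p)) t + d t * poly p t)"
    by (rule pairing[symmetric])
  also have "\<dots> = (\<Sum>t\<in>{s}. c t * poly (p + pCons 0 (pderiv p)) t + d t * poly p t)"
    using T s zero by (intro sum.mono_neutral_right) auto
  \<comment> \<open>The zero at \<open>s\<close> is simple: the term with \<open>d s\<close> drops
    out, while \<open>c s\<close> keeps the factor \<open>s * p'(s)\<close>, nonzero because
    \<open>s\<close> is.\<close>
  also have "\<dots> = c s * (s * poly q s)" by (simp add: p's) (simp add: p_def)
  finally show ?thesis using s qs by simp
qed

section \<open>The span of geometric sequences and its square domain\<close>

definition geo :: "complex \<Rightarrow> nat \<Rightarrow> complex" where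
  "geo t = (\<lambda>k. t ^ k)"

text \<open>The base 0 must be excluded: as \<open>0 ^ 0 = 1\<close>, \<open>geo 0\<close> is
  \<open>unit_seq 0\<close>, an eigenvector of \<open>mul\<close>, and would lie in the square
  domain.\<close>

definition geo_span :: "(nat \<Rightarrow> complex) set" where
  "geo_span = module.span scl (geo ` {t. t \<noteq> 0 \<and> cmod t < 1})"

lemma summable_square:
  fixes a :: "nat \<Rightarrow> real"
  assumes "summable a" "\<And>k. 0 \<le> a k"
  shows "summable (\<lambda>k. (a k)\<^sup>2)"
proof -
  have "\<forall>\<^sub>F k in sequentially. a k < 1"
    using summable_LIMSEQ_zero[OF assms(1)] by (rule order_tendstoD) simp
  then obtain N where "\<And>k. k \<ge> N \<Longrightarrow> a k < 1" by (auto simp: eventually_sequentially)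
  then have "\<And>k. k \<ge> N \<Longrightarrow> norm ((a k)\<^sup>2) \<le> a k"
    using assms(2) by (simp add: power2_eq_square mult_left_le less_imp_le)
  then show ?thesis by (rule summable_comparison_test'[OF assms(1)])
qed

text \<open>The differentiated geometric series makes \<open>(k + 1) |t|^k\<close> summable, hence
  also square-summable.\<close>

lemma geo_mul_dom:
  assumes "cmod t < 1"
  shows "geo t \<in> mul_dom"
proof -
  have "summable (\<lambda>k. real (Suc k) * cmod t ^ k)"
    using geometric_deriv_sums[of "cmod t"] assms by (simp add: sums_iff)
  then have "summable (\<lambda>k. (real (Suc k) * cmod t ^ k)\<^sup>2)" by (rule summable_square) simp
  then show ?thesis
    by (simp add: mul_dom_def l2_def mul_def geo_def norm_mult norm_power del: of_nat_Suc)
qed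

lemma subspace_geo_span: "l2.subspace geo_span"
  by (simp add: geo_span_def)

lemma geo_span_subset_mul_dom: "geo_span \<subseteq> mul_dom"
  unfolding geo_span_def using subspace_mul_dom geo_mul_dom by (intro l2.span_minimal) auto

text \<open>Allowing every finite superset \<open>G\<close> lets two elements be expanded over a
  common set of bases.\<close>

lemma geo_span_expansion:
  assumes "x \<in> geo_span"
  obtains F c where "finite F" "0 \<notin> F"
    "\<And>G. finite G \<Longrightarrow> F \<subseteq> G \<Longrightarrow> x = (\<lambda>k. \<Sum>t\<in>G. c t * t ^ k)"
proof -
  obtain V r where V: "finite V" "V \<subseteq> geo ` {t. t \<noteq> 0 \<and> cmod t < 1}"
      "x = (\<Sum>v\<in>V. scl (r v) v)"
    using assms unfolding geo_span_def l2.span_explicit by blast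
  then obtain F where F: "F \<subseteq> {t. t \<noteq> 0 \<and> cmod t < 1}" "finite F" "V = geo ` F"
    using finite_subset_image[OF V(1,2)] by blast
  have inj: "inj_on geo F" by (rule inj_onI) (metis geo_def power_one_right)
  \<comment> \<open>The value 0 outside \<open>F\<close> is what permits enlarging the index
    set.\<close>
  define c where "c = (\<lambda>t. if t \<in> F then r (geo t) else 0)"
  have x: "x k = (\<Sum>t\<in>F. c t * t ^ k)" for k
  proof -
    have "(\<Sum>v\<in>V. scl (r v) v) k = (\<Sum>v\<in>V. r v * v k)"
      using V(1) by (induction V rule: finite_induct) auto
    also have "\<dots> = (\<Sum>t\<in>F. r (geo t) * geo t k)" unfolding F(3) using inj by (simp add: sum.reindex)
    finally show ?thesis using V(3) by (simp add: c_def geo_def)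
  qed
  show thesis
  proof (rule that[of F c])
    show "x = (\<lambda>k. \<Sum>t\<in>G. c t * t ^ k)" if "finite G" "F \<subseteq> G" for G
      unfolding fun_eq_iff x using that
      by (intro allI sum.mono_neutral_left) (auto simp: c_def)
  qed (use F in \<open>auto simp: c_def\<close>)
qed

lemma square_dom_geo_span: "square_dom geo_span mul = {0}"
proof (intro equalityI subsetI)
  fix x assume "x \<in> square_dom geo_span mul"
  then have x: "x \<in> geo_span" and y: "mul x \<in> geo_span" by (auto simp: square_dom_def)
  obtain F c where F: "finite F" "0 \<notin> F"
    "\<And>G. finite G \<Longrightarrow> F \<subseteq> G \<Longrightarrow> x = (\<lambda>k. \<Sum>t\<in>G. c t * t ^ k)"
    using geo_span_expansion[OF x] by metis
  obtain F' d where F': "finite F'" "0 \<notin> F'"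
    "\<And>G. finite G \<Longrightarrow> F' \<subseteq> G \<Longrightarrow> mul x = (\<lambda>k. \<Sum>t\<in>G. d t * t ^ k)"
    using geo_span_expansion[OF y] by metis
  define G where "G = F \<union> F'"
  have G: "finite G" "0 \<notin> G" "F \<subseteq> G" "F' \<subseteq> G" using F F' by (auto simp: G_def)
  have xG: "x = (\<lambda>k. \<Sum>t\<in>G. c t * t ^ k)" using F(3) G by blast
  have yG: "mul x = (\<lambda>k. \<Sum>t\<in>G. d t * t ^ k)" using F'(3) G by blast
  \<comment> \<open>Coordinate \<open>k\<close> of \<open>mul x\<close> computed from both
    expansions; the difference has the shape required by \<open>geometric_independent\<close>, with
    \<open>- d\<close> for \<open>d\<close>.\<close>
  have "(\<Sum>t\<in>G. (of_nat (Suc k) * c t + - d t) * t ^ k) = 0" for k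
  proof -
    have "of_nat (Suc k) * (\<Sum>t\<in>G. c t * t ^ k) = (\<Sum>t\<in>G. d t * t ^ k)"
      using fun_cong[OF yG, of k] fun_cong[OF xG, of k] by (simp add: mul_def)
    then show ?thesis
      by (simp add: sum_distrib_left algebra_simps sum.distrib sum_subtractf sum_negf del: of_nat_Suc)
  qed
  then have "c t = 0" if "t \<in> G" for t
    using geometric_independent[of G c "\<lambda>t. - d t" t] G that by auto
  then show "x \<in> {0}" using xG by (simp add: fun_eq_iff)
next
  fix x :: "nat \<Rightarrow> complex" assume "x \<in> {0}"
  then show "x \<in> square_dom geo_span mul"
    using l2.subspace_0[OF subspace_geo_span] by (simp add: square_dom_def mul_zero)
qed

section \<open>Density of the range\<close>

lemma unit_seq_in_closure_range_geo_span:
  "unit_seq j \<in> l2.hs.mtopology closure_of (mul ` geo_span)"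
proof -
  let ?K = "l2.hs.mtopology closure_of (mul ` geo_span)"
  have Rl: "mul ` geo_span \<subseteq> l2" using geo_span_subset_mul_dom by (auto simp: mul_dom_def)
  then have KH: "?K \<subseteq> l2" by (auto simp: l2.in_closure_of_iff)
  have K: "l2.subspace ?K"
    using subspace_image_mul[OF subspace_geo_span] Rl by (rule l2.subspace_closure_of)
  \<comment> \<open>Strong induction: the terms subtracted from \<open>geo t\<close> involve
    \<open>unit_seq i\<close> for \<open>i < j\<close>, whose images are known only to lie in the
    closure \<open>?K\<close>.\<close>
  have "mul (unit_seq j) \<in> ?K"
  proof (induction j rule: less_induct)
    case (less j)
    \<comment> \<open>\<open>h t\<close> clears the coordinates below \<open>j\<close>; division by
      \<open>t ^ j\<close> makes coordinate \<open>j\<close> equal to 1. The remainder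
      \<open>r t\<close> is \<open>t, t^2, ...\<close> from coordinate \<open>j + 1\<close>
      on.\<close>
    define h where "h t = geo t - (\<Sum>i<j. scl (t ^ i) (unit_seq i))" for t
    define r where "r t = scl (inverse (t ^ j)) (h t) - unit_seq j" for t
    have h_dom: "h t \<in> mul_dom" if "cmod t < 1" for t
      unfolding h_def using that
      by (intro l2.subspace_diff[OF subspace_mul_dom] l2.subspace_sum[OF subspace_mul_dom]
          l2.subspace_scale[OF subspace_mul_dom] geo_mul_dom unit_seq_mul_dom)
    have r_dom: "r t \<in> mul_dom" if "cmod t < 1" for t
      unfolding r_def using that
      by (intro l2.subspace_diff[OF subspace_mul_dom] l2.subspace_scale[OF subspace_mul_dom]
          h_dom unit_seq_mul_dom)
    have hK: "mul (h t) \<in> ?K" if t: "t \<noteq> 0" "cmod t < 1" for t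
    proof -
      have "geo t \<in> geo_span" using t by (auto simp: geo_span_def intro!: l2.span_base)
      then have 1: "mul (geo t) \<in> ?K" using Rl closure_of_subset[of "mul ` geo_span" l2.hs.mtopology] by auto
      have 2: "mul (\<Sum>i<j. scl (t ^ i) (unit_seq i)) = (\<Sum>i<j. scl (t ^ i) (mul (unit_seq i)))"
        by (simp only: mul_sum mul_scl)
      show ?thesis unfolding h_def mul_diff 2 using less
        by (intro l2.subspace_diff[OF K] 1 l2.subspace_sum[OF K] l2.subspace_scale[OF K]) auto
    qed
    have r_apply: "r t k = (if k \<le> j then 0 else t ^ (k - j))" if "t \<noteq> 0" for t k
    proof -
      have "h t k = (if k < j then 0 else t ^ k)" by (simp add: h_def sum_unit_seq_apply geo_def)
      then show ?thesis using that by (auto simp: r_def unit_seq_def power_diff field_simps)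
    qed
    define C where "C = l2.cnorm (mul (r (1 / 2)))"
    have C: "C \<ge> 0" unfolding C_def using r_dom[of "1 / 2"] by (intro l2.cnorm_nonneg) (simp add: mul_dom_def)
    \<comment> \<open>Coordinatewise \<open>|r\<^sub>t| \<le> 2 |t| |r\<^sub>1\<^sub>/\<^sub>2|\<close>, so \<open>r\<^sub>t\<close> tends to \<open>0\<close> linearly in \<open>t\<close>.\<close>
    have r_bound: "l2.cnorm (mul (r (of_real \<tau>))) \<le> 2 * \<tau> * C" if \<tau>: "0 < \<tau>" "\<tau> \<le> 1 / 2" for \<tau>
    proof -
      \<comment> \<open>Keep one factor \<tau> and bound the other \<open>n - 1\<close> by
        \<open>1 / 2\<close>; the 2 restores the missing power. Here \<open>n\<close> will be
        \<open>k - j\<close>.\<close>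
      have *: "\<tau> ^ n \<le> 2 * \<tau> * (1 / 2) ^ n" if n: "n > 0" for n
      proof -
        obtain m where m: "n = Suc m" using n by (cases n) auto
        have "\<tau> * \<tau> ^ m \<le> \<tau> * (1 / 2) ^ m" using \<tau> by (intro mult_left_mono power_mono) auto
        then show ?thesis by (simp add: m)
      qed
      have "l2.cnorm (mul (r (of_real \<tau>))) \<le> l2.cnorm (scl (of_real (2 * \<tau>)) (mul (r (1 / 2))))"
      proof (rule l2_norm_mono)
        show "scl (of_real (2 * \<tau>)) (mul (r (1 / 2))) \<in> l2"
          using r_dom[of "1 / 2"] by (intro l2_scl) (simp add: mul_dom_def)
        show "cmod (mul (r (of_real \<tau>)) k) \<le> cmod (scl (of_real (2 * \<tau>)) (mul (r (1 / 2))) k)" for k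
        proof (cases "k \<le> j")
          case True
          then show ?thesis using \<tau> by (simp add: mul_def r_apply)
        next
          case False
          have "real (Suc k) * \<tau> ^ (k - j) \<le> real (Suc k) * (2 * \<tau> * (1 / 2) ^ (k - j))"
            using False by (intro mult_left_mono *) auto
          then show ?thesis using False \<tau>
            by (simp add: mul_def r_apply norm_mult norm_power norm_divide mult_ac del: of_nat_Suc)
        qed
      qed
      also have "\<dots> = cmod (of_real (2 * \<tau>)) * C"
        unfolding C_def using r_dom[of "1 / 2"] by (intro l2.cnorm_scale) (simp add: mul_dom_def)
      finally show ?thesis using \<tau> by simp
    qed
    have "\<exists>y\<in>?K. l2.cnorm (mul (unit_seq j) - y) < e" if e: "e > 0" for e
    proof -
      \<comment> \<open>The bound \<open>1 / 2\<close> serves \<open>r_bound\<close>, the other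
        makes the error \<open>2 * \<tau> * C\<close> less than \<open>e\<close>;
        \<open>C + 1\<close> guards against \<open>C = 0\<close>.\<close>
      define \<tau> where "\<tau> = min (1 / 2) (e / (2 * (C + 1)))"
      have \<tau>: "\<tau> \<le> 1 / 2" "\<tau> \<le> e / (2 * (C + 1))"
        unfolding \<tau>_def by (rule min.cobounded1, rule min.cobounded2)
      have \<tau>0: "0 < \<tau>" using e C by (simp add: \<tau>_def)
      define y where "y = mul (scl (inverse (of_real \<tau> ^ j)) (h (of_real \<tau>)))"
      have y: "y \<in> ?K" unfolding y_def mul_scl using \<tau>0 \<tau> by (intro l2.subspace_scale[OF K] hK) auto
      have "l2.cnorm (mul (unit_seq j) - y) = l2.cnorm (y - mul (unit_seq j))"
        using y KH unit_seq_mul_dom by (intro l2.cnorm_minus_commute) (auto simp: mul_dom_def)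
      also have "\<dots> = l2.cnorm (mul (r (of_real \<tau>)))" by (simp add: y_def r_def mul_diff)
      also have "\<dots> \<le> 2 * \<tau> * C" using \<tau>0 \<tau>(1) by (rule r_bound)
      also have "\<dots> < 2 * \<tau> * (C + 1)" using \<tau>0 by simp
      also have "\<dots> \<le> 2 * (e / (2 * (C + 1))) * (C + 1)"
        using C \<tau> by (intro mult_right_mono mult_left_mono) auto
      also have "\<dots> = e" using C by (simp add: add_nonneg_eq_0_iff field_simps)
      finally show ?thesis using y by blast
    qed
    \<comment> \<open>The approximants lie in \<open>?K\<close> rather than in the range itself, so
      idempotence of the closure finishes the step.\<close>
    then have "mul (unit_seq j) \<in> l2.hs.mtopology closure_of ?K"
      using unit_seq_mul_dom by (intro iffD2[OF l2.in_closure_of_iff[OF KH]]) (auto simp: mul_dom_def)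
    then show ?case by simp
  qed
  then have "scl (inverse (of_nat (Suc j))) (mul (unit_seq j)) \<in> ?K"
    by (rule l2.subspace_scale[OF K])
  then show ?thesis by (simp add: mul_unit_seq del: of_nat_Suc)
qed

theorem proposition2p3:
  shows "\<exists>(scale :: complex \<Rightarrow> (nat \<Rightarrow> complex) \<Rightarrow> (nat \<Rightarrow> complex)) H cinner D A.
           complex_hilbert_space scale H cinner \<and> H \<noteq> {0} \<and>
           complex_inner_space.essentially_self_adjoint scale H cinner D A \<and>
           square_dom D A = {0}"
proof (intro exI conjI)
  show "complex_hilbert_space scl l2 ip" by (rule complex_hilbert_space_l2)
  have "unit_seq 0 0 \<noteq> 0" by (simp add: unit_seq_def)
  then have "unit_seq 0 \<noteq> 0" by (metis zero_fun_apply)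
  then show "l2 \<noteq> {0}" using unit_seq_l2[of 0] by blast
  show "l2.essentially_self_adjoint geo_span mul"
    using subspace_geo_span geo_span_subset_mul_dom unit_seq_in_closure_range_geo_span
    by (rule essentially_self_adjoint_mul)
  show "square_dom geo_span mul = {0}" by (rule square_dom_geo_span)
qed

end
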